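(* Let $\mathcal{R} = \langle R; <, +, \ldots\rangle$ be an expansion of a divisible ordered Abelian group with dp-rank at most $2$, and suppose that there is an infinite definable discrete set $D \subseteq R$ in $\mathcal{R}$. Then there is no definable set $X \subseteq R$ which is dense and codense in an interval $I$ of $\mathcal{R}$, nor is there a definable Cantor-like set in $\mathcal{R}$.
   Context: Standing assumptions: the ordered group is densely ordered, and $\mathcal{R}$ is sufficiently saturated ($|T|^+$-saturated, where $T = \mathrm{Th}(\mathcal{R})$). "Definable" means definable in $\mathcal{R}$ with parameters. All topological notions refer to the order topology generated by open intervals. A set is discrete if each of its points is isolated in it. A set $X$ is dense and codense in a (nonempty open) interval $I$ if both $X \cap I$ and $I \setminus X$ are dense in $I$. A set $X \subseteq R$ is Cantor-like if it is nonempty, closed, nowhere dense, and has no isolated points. An ict-pattern of depth $\kappa$ in a partial type $p(\overline{x})$ is a sequence of formulas $\{\varphi_i(\overline{x};\overline{y}_i) : i<\kappa\}$ and a sequence of tuples $\{\overline{a}_{i,j} : i<\kappa, j<\omega\}$ from some model of $T$ such that for every $\eta : \kappa \to \omega$ the set consisting of $p(\overline{x})$, all $\varphi_i(\overline{x};\overline{a}_{i,\eta(i)})$ for $i<\kappa$, and all $\neg\varphi_i(\overline{x};\overline{a}_{i,j})$ for $i<\kappa$, $j \neq \eta(i)$, is consistent. The partial type $p$ has dp-rank less than $\kappa$ if there is no ict-pattern of depth $\kappa$ in $p$; its dp-rank is $\lambda$ if the least $\kappa$ such that the dp-rank of $p$ is less than $\kappa$ is $\lambda^+$. The dp-rank of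 $\mathcal{R}$ (or of $T$) is the dp-rank of the partial type $x=x$ in a single variable $x$. In particular dp-rank at most $2$ means that there is no ict-pattern of depth $3$ in $x=x$. *)

theory Defs
  imports "HOL-Analysis.Analysis"
begin

unbundle cardinal_syntax

section \<open>First-order logic\<close>

text \<open>The symbols of a language are the elements of the types \<open>'f\<close> and \<open>'r\<close>. A structure has the
whole type \<open>'a\<close> as its universe; its values on argument lists of the wrong length never matter,
because only well-formed formulas are considered.\<close>

record ('f, 'r) language =
  fun_arity :: "'f \<Rightarrow> nat"
  rel_arity :: "'r \<Rightarrow> nat"

record ('f, 'r, 'a) fo_structure =
  fun_interp :: "'f \<Rightarrow> 'a list \<Rightarrow> 'a"
  rel_interp :: "'r \<Rightarrow> 'a list \<Rightarrow> bool"

datatype 'f fo_term = Var nat | Fn 'f "'f fo_term list"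

datatype ('f, 'r) fm =
    Eq "'f fo_term" "'f fo_term"
  | Rel 'r "'f fo_term list"
  | Neg "('f, 'r) fm"
  | Conj "('f, 'r) fm" "('f, 'r) fm"
  | Ex nat "('f, 'r) fm"

fun wf_term :: "('f, 'r) language \<Rightarrow> 'f fo_term \<Rightarrow> bool" where
  "wf_term L (Var n) \<longleftrightarrow> True"
| "wf_term L (Fn f ts) \<longleftrightarrow> length ts = fun_arity L f \<and> (\<forall>t \<in> set ts. wf_term L t)"

fun wf_fm :: "('f, 'r) language \<Rightarrow> ('f, 'r) fm \<Rightarrow> bool" where
  "wf_fm L (Eq s t) \<longleftrightarrow> wf_term L s \<and> wf_term L t"
| "wf_fm L (Rel r ts) \<longleftrightarrow> length ts = rel_arity L r \<and> (\<forall>t \<in> set ts. wf_term L t)"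
| "wf_fm L (Neg \<phi>) \<longleftrightarrow> wf_fm L \<phi>"
| "wf_fm L (Conj \<phi> \<psi>) \<longleftrightarrow> wf_fm L \<phi> \<and> wf_fm L \<psi>"
| "wf_fm L (Ex n \<phi>) \<longleftrightarrow> wf_fm L \<phi>"

fun term_vars :: "'f fo_term \<Rightarrow> nat set" where
  "term_vars (Var n) = {n}"
| "term_vars (Fn f ts) = (\<Union>t \<in> set ts. term_vars t)"

fun free_vars :: "('f, 'r) fm \<Rightarrow> nat set" where
  "free_vars (Eq s t) = term_vars s \<union> term_vars t"
| "free_vars (Rel r ts) = (\<Union>t \<in> set ts. term_vars t)"
| "free_vars (Neg \<phi>) = free_vars \<phi>"
| "free_vars (Conj \<phi> \<psi>) = free_vars \<phi> \<union> free_vars \<psi>"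
| "free_vars (Ex n \<phi>) = free_vars \<phi> - {n}"

fun term_val :: "('f, 'r, 'a) fo_structure \<Rightarrow> (nat \<Rightarrow> 'a) \<Rightarrow> 'f fo_term \<Rightarrow> 'a" where
  "term_val M e (Var n) = e n"
| "term_val M e (Fn f ts) = fun_interp M f (map (term_val M e) ts)"

fun sat :: "('f, 'r, 'a) fo_structure \<Rightarrow> (nat \<Rightarrow> 'a) \<Rightarrow> ('f, 'r) fm \<Rightarrow> bool" where
  "sat M e (Eq s t) \<longleftrightarrow> term_val M e s = term_val M e t"
| "sat M e (Rel r ts) \<longleftrightarrow> rel_interp M r (map (term_val M e) ts)"
| "sat M e (Neg \<phi>) \<longleftrightarrow> \<not> sat M e \<phi>"
| "sat M e (Conj \<phi> \<psi>) \<longleftrightarrow> sat M e \<phi> \<and> sat M e \<psi>"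
| "sat M e (Ex n \<phi>) \<longleftrightarrow> (\<exists>a. sat M (e(n := a)) \<phi>)"

definition Th :: "('f, 'r) language \<Rightarrow> ('f, 'r, 'a) fo_structure \<Rightarrow> ('f, 'r) fm set" where
  "Th L M = {\<phi>. wf_fm L \<phi> \<and> free_vars \<phi> = {} \<and> (\<forall>e. sat M e \<phi>)}"

definition models :: "('f, 'r, 'a) fo_structure \<Rightarrow> ('f, 'r) fm set \<Rightarrow> bool" where
  "models M T \<longleftrightarrow> (\<forall>\<phi> \<in> T. \<forall>e. sat M e \<phi>)"

text \<open>Definability is with parameters: \<open>e\<close> assigns them to the free variables other than \<open>0\<close>.\<close>

definition definable :: "('f, 'r) language \<Rightarrow> ('f, 'r, 'a) fo_structure \<Rightarrow> 'a set \<Rightarrow> bool" where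
  "definable L M X \<longleftrightarrow> (\<exists>\<phi> e. wf_fm L \<phi> \<and> X = {x. sat M (e(0 := x)) \<phi>})"

section \<open>Types and saturation\<close>

text \<open>Relative to a set \<open>V\<close> of variables (the tuple \<open>x\<close>), a pair \<open>(\<phi>, e)\<close> stands for the formula
\<open>\<phi>(x; a)\<close> in which the free variables outside \<open>V\<close> are replaced by the parameters that \<open>e\<close> assigns
to them; the values of \<open>e\<close> on \<open>V\<close> are irrelevant.\<close>

definition realizes ::
  "('f, 'r, 'a) fo_structure \<Rightarrow> nat set \<Rightarrow> (nat \<Rightarrow> 'a) \<Rightarrow> (('f, 'r) fm \<times> (nat \<Rightarrow> 'a)) set \<Rightarrow> bool" where
  "realizes M V x \<Sigma> \<longleftrightarrow> (\<forall>(\<phi>, e) \<in> \<Sigma>. sat M (override_on e x V) \<phi>)"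

text \<open>Consistency of a set of formulas with parameters from \<open>M\<close> is consistency with the elementary
diagram of \<open>M\<close>, that is, finite satisfiability in \<open>M\<close>.\<close>

definition consistent ::
  "('f, 'r, 'a) fo_structure \<Rightarrow> nat set \<Rightarrow> (('f, 'r) fm \<times> (nat \<Rightarrow> 'a)) set \<Rightarrow> bool" where
  "consistent M V \<Sigma> \<longleftrightarrow> (\<forall>\<Sigma>' \<subseteq> \<Sigma>. finite \<Sigma>' \<longrightarrow> (\<exists>x. realizes M V x \<Sigma>'))"

definition saturated :: "('f, 'r) language \<Rightarrow> ('f, 'r, 'a) fo_structure \<Rightarrow> 'k rel \<Rightarrow> bool" where
  "saturated L M \<kappa> \<longleftrightarrow>
    (\<forall>A V \<Sigma>. |A| <o \<kappa> \<longrightarrow> finite V \<longrightarrow>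
      (\<forall>(\<phi>, e) \<in> \<Sigma>. wf_fm L \<phi> \<and> e ` (free_vars \<phi> - V) \<subseteq> A) \<longrightarrow>
      consistent M V \<Sigma> \<longrightarrow> (\<exists>x. realizes M V x \<Sigma>))"

section \<open>Dp-rank\<close>

text \<open>An ict-pattern in the partial type \<open>p\<close> (a set of formulas without parameters, with free
variables in \<open>V\<close>), of depth the cardinality of the index set \<open>I\<close> and with the tuples taken in \<open>N\<close>.
The tuple \<open>a\<^sub>i\<^sub>j\<close> is given by the values of \<open>a i j\<close> on the free variables of \<open>\<phi> i\<close> outside \<open>V\<close>.\<close>

definition ict_pattern ::
  "('f, 'r) language \<Rightarrow> ('f, 'r, 'a) fo_structure \<Rightarrow> nat set \<Rightarrow> ('f, 'r) fm set \<Rightarrow>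
   'i set \<Rightarrow> ('i \<Rightarrow> ('f, 'r) fm) \<Rightarrow> ('i \<Rightarrow> nat \<Rightarrow> nat \<Rightarrow> 'a) \<Rightarrow> bool" where
  "ict_pattern L N V p I \<phi> a \<longleftrightarrow>
    (\<forall>i \<in> I. wf_fm L (\<phi> i)) \<and>
    (\<forall>\<eta> :: 'i \<Rightarrow> nat.
      consistent N V
        (p \<times> UNIV \<union>
         {(\<phi> i, a i (\<eta> i)) | i. i \<in> I} \<union>
         {(Neg (\<phi> i), a i j) | i j. i \<in> I \<and> j \<noteq> \<eta> i}))"

text \<open>Dp-rank less than a finite \<open>\<kappa>\<close>, for the theory of \<open>M\<close>. The tuples of a pattern may come from
any model of the theory; \<open>N\<close> ranges over the models with the same universe \<open>'a\<close> as \<open>M\<close>. When the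
universe is infinite and at least as large as the theory (in particular when \<open>M\<close> is infinite and
\<open>|T|\<^sup>+\<close>-saturated), this is no restriction: a pattern of finite depth involves countably many
elements, so by Loewenheim-Skolem it can be found in a model of cardinality that of \<open>'a\<close>.\<close>

definition dp_rank_less ::
  "('f, 'r) language \<Rightarrow> ('f, 'r, 'a) fo_structure \<Rightarrow> nat set \<Rightarrow> ('f, 'r) fm set \<Rightarrow> nat \<Rightarrow> bool" where
  "dp_rank_less L M V p \<kappa> \<longleftrightarrow>
    \<not> (\<exists>(N :: ('f, 'r, 'a) fo_structure) \<phi> a. models N (Th L M) \<and> ict_pattern L N V p {..<\<kappa>} \<phi> a)"

definition dp_rank_at_most :: "('f, 'r) language \<Rightarrow> ('f, 'r, 'a) fo_structure \<Rightarrow> nat \<Rightarrow> bool" where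
  "dp_rank_at_most L M n \<longleftrightarrow> dp_rank_less L M {0} {Eq (Var 0) (Var 0)} (Suc n)"

section \<open>Expansions of ordered groups, and topology of the line\<close>

definition expands_ordered_group ::
  "('f, 'r) language \<Rightarrow> ('f, 'r, 'a :: linordered_ab_group_add) fo_structure \<Rightarrow> bool" where
  "expands_ordered_group L M \<longleftrightarrow>
    (\<exists>less. rel_arity L less = 2 \<and> (\<forall>x y. rel_interp M less [x, y] \<longleftrightarrow> x < y)) \<and>
    (\<exists>plus. fun_arity L plus = 2 \<and> (\<forall>x y. fun_interp M plus [x, y] = x + y))"

definition divisible :: "'a :: ab_group_add itself \<Rightarrow> bool" where
  "divisible TYPE('a) \<longleftrightarrow> (\<forall>n :: nat. n > 0 \<longrightarrow> (\<forall>x :: 'a. \<exists>y. (\<Sum>i<n. y) = x))"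

definition open_interval :: "'a :: linorder set \<Rightarrow> bool" where
  "open_interval I \<longleftrightarrow>
    I \<noteq> {} \<and> ((\<exists>a b. I = {a<..<b}) \<or> (\<exists>a. I = {a<..}) \<or> (\<exists>b. I = {..<b}) \<or> I = UNIV)"

definition dense_codense_in :: "'a :: topological_space set \<Rightarrow> 'a set \<Rightarrow> bool" where
  "dense_codense_in X I \<longleftrightarrow> I \<subseteq> closure (X \<inter> I) \<and> I \<subseteq> closure (I - X)"

definition cantor_like :: "'a :: topological_space set \<Rightarrow> bool" where
  "cantor_like X \<longleftrightarrow>
    X \<noteq> {} \<and> closed X \<and> interior (closure X) = {} \<and> (\<forall>x \<in> X. \<not> x isolated_in X)"

end

theory Submission
  imports Defs "HOL-Library.Ramsey"
begin

text \<open>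
The discrete set supplies one row of an ict-pattern for free. Infinitely many of its points
\<open>d\<^sub>j\<close> are separated from the rest of \<open>D\<close> by a common distance \<open>\<epsilon>\<close>, so an element \<open>x\<close> just above
\<open>d\<^sub>j\<close> determines both \<open>d\<^sub>j\<close> and the offset \<open>t = x - d\<^sub>j\<close>, and definably so. Which \<open>d\<^sub>j\<close> is chosen
is independent of any condition on \<open>t\<close>. Hence dp-rank at most \<open>2\<close> forbids every ict-pattern with
two rows that is realized by offsets \<open>t\<close> in \<open>(0, \<epsilon>)\<close> (lemma \<open>no_local_pattern\<close>). The rest of the
proof finds such a pattern whenever a bad set \<open>X\<close> exists. Its first row says in which of
infinitely many disjoint intervals \<open>t\<close> lies, its second row which one of infinitely many
differences \<open>(X - b\<^sub>k) \<triangle> (X - c\<^sub>k)\<close> of translates of \<open>X\<close> contains \<open>t\<close>.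

Suppose that the complement of \<open>X\<close> is dense and that infinitely many \<open>b\<close>, within less than \<open>\<epsilon>\<close>
of each other, are limits of \<open>X\<close> from the right (lemma \<open>pattern_of_accumulation\<close>). By Ramsey's
theorem, infinitely many of these \<open>b\<close> have either pairwise different or equal germs of \<open>X - b\<close> at
\<open>0\<^sup>+\<close>.

If the germs differ, infinitely many Boolean combinations of translates of \<open>X\<close> have points
arbitrarily close to \<open>0\<close>; the intervals of the first row are chosen to shrink towards \<open>0\<close>
(lemma \<open>pattern_of_distinct_germs\<close>).

If the germs are equal to the germ of one set \<open>Q\<close>, there is a common \<open>\<delta>\<close> such that \<open>X\<close> looks on
every \<open>(b, b + \<delta>)\<close> like \<open>Q\<close> on \<open>(0, \<delta>)\<close>. The intervals \<open>(b, b + \<delta>)\<close> form the first row and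
translates of \<open>Q\<close> by small elements the second, provided that \<open>Q\<close> has infinitely many different
small translates. Finitely many are impossible in a divisible group: divide the distance between
two close points, only one of them in \<open>Q\<close>, into equal steps. By the pigeonhole principle some
multiple of a step is a local period of \<open>Q\<close>, and it can be taken to divide the distance
(lemmas \<open>infinitely_many_translates\<close> and \<open>pattern_of_equal_germs\<close>).

For \<open>X\<close> dense and codense in \<open>I\<close>, every point of \<open>I\<close> is such a \<open>b\<close>. For a Cantor-like \<open>X\<close>, every point
of \<open>X\<close> is a limit of \<open>X\<close> from the right or from the left, and passing to \<open>-X\<close> exchanges the sides.

Saturation enters in one way only: a countable set of positive elements has a positive lower
bound. It allows countably many smallness conditions to be met by a single choice.
\<close>

section \<open>Sets separated by points\<close>

lemma homogeneous_subsequence: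
  fixes P :: "nat \<Rightarrow> nat \<Rightarrow> bool"
  obtains g :: "nat \<Rightarrow> nat" and c where "strict_mono g" "\<And>m n. m < n \<Longrightarrow> P (g m) (g n) \<longleftrightarrow> c"
proof -
  define f :: "nat set \<Rightarrow> nat" where "f A = (if P (Min A) (Max A) then 1 else 0)" for A
  have "\<forall>x\<in>UNIV. \<forall>y\<in>UNIV. x \<noteq> y \<longrightarrow> f {x, y} < 2"
    by (simp add: f_def)
  from Ramsey2[OF infinite_UNIV_nat this] obtain Y t
    where "Y \<subseteq> UNIV \<and> infinite Y \<and> t < 2 \<and> (\<forall>x\<in>Y. \<forall>y\<in>Y. x \<noteq> y \<longrightarrow> f {x, y} = t)"
    by (elim exE)
  then have Y: "infinite Y" "\<And>x y. x \<in> Y \<Longrightarrow> y \<in> Y \<Longrightarrow> x \<noteq> y \<Longrightarrow> f {x, y} = t"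
    by simp_all
  let ?g = "enumerate Y"
  have mono: "strict_mono ?g"
    using Y(1) by (rule strict_mono_enumerate)
  have "P (?g m) (?g n) \<longleftrightarrow> t = 1" if "m < n" for m n
  proof -
    have lt: "?g m < ?g n" using mono that by (simp add: strict_mono_less)
    then have "f {?g m, ?g n} = t"
      using Y(1) by (intro Y(2)) (simp_all add: enumerate_in_set less_imp_neq)
    moreover have "Min {?g m, ?g n} = ?g m" "Max {?g m, ?g n} = ?g n"
      using lt by auto
    ultimately show ?thesis by (auto simp: f_def split: if_splits)
  qed
  then show thesis using mono that[of ?g "t = 1"] by blast
qed

text \<open>This is the source of the second row of every pattern. Splitting an infinite family by a
point leaves an infinite part; iterating gives sets \<open>S\<^sub>n\<close> and points \<open>q\<^sub>n\<close> such that all later sets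
disagree with \<open>S\<^sub>n\<close> about \<open>q\<^sub>n\<close>. By Ramsey's theorem the earlier sets may be assumed to all agree or
to all disagree with \<open>S\<^sub>n\<close> about \<open>q\<^sub>n\<close>, after thinning out. In both cases \<open>q\<^bsub>2i\<^esub>\<close> distinguishes \<open>S\<^bsub>2j\<^esub>\<close> from its
successor \<open>S\<^bsub>2j+1\<^esub>\<close> exactly if \<open>i = j\<close>.\<close>
lemma infinite_family_diagonal:
  fixes \<S> :: "'b set set"
  assumes "infinite \<S>"
  obtains A B :: "nat \<Rightarrow> 'b set" and p :: "nat \<Rightarrow> 'b"
  where "range A \<subseteq> \<S>" "range B \<subseteq> \<S>" "\<And>i j. (p i \<in> A j) \<noteq> (p i \<in> B j) \<longleftrightarrow> i = j"
proof -
  have step: "\<exists>p S \<T>'. S \<in> \<T> \<and> \<T>' \<subseteq> \<T> \<and> infinite \<T>' \<and> (\<forall>S'\<in>\<T>'. (p \<in> S') \<noteq> (p \<in> S))"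
    if inf: "infinite \<T>" for \<T> :: "'b set set"
  proof -
    obtain S1 where S1: "S1 \<in> \<T>" using inf by (metis finite.emptyI ex_in_conv)
    have "\<not> \<T> \<subseteq> {S1}" using inf by (meson finite.emptyI finite.insertI finite_subset)
    then obtain S2 where S2: "S2 \<in> \<T>" "S2 \<noteq> S1" by blast
    then obtain p where p: "(p \<in> S1) \<noteq> (p \<in> S2)" by blast
    have "\<T> \<subseteq> {S\<in>\<T>. (p \<in> S) \<noteq> (p \<in> S1)} \<union> {S\<in>\<T>. (p \<in> S) \<noteq> (p \<in> S2)}"
      using p by blast
    then have "infinite {S\<in>\<T>. (p \<in> S) \<noteq> (p \<in> S1)} \<or> infinite {S\<in>\<T>. (p \<in> S) \<noteq> (p \<in> S2)}"
      using inf by (meson finite_UnI finite_subset)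
    then show ?thesis
    proof
      assume "infinite {S\<in>\<T>. (p \<in> S) \<noteq> (p \<in> S1)}"
      then show ?thesis using S1
        by (intro exI[of _ p] exI[of _ S1] exI[of _ "{S\<in>\<T>. (p \<in> S) \<noteq> (p \<in> S1)}"]) auto
    next
      assume "infinite {S\<in>\<T>. (p \<in> S) \<noteq> (p \<in> S2)}"
      then show ?thesis using S2(1)
        by (intro exI[of _ p] exI[of _ S2] exI[of _ "{S\<in>\<T>. (p \<in> S) \<noteq> (p \<in> S2)}"]) auto
    qed
  qed
  \<comment> \<open>A state \<open>z\<close> records the chosen point, the set that is split off, and the remaining family.\<close>
  define R where "R \<T> z \<longleftrightarrow> (case z of (p, S, \<T>') \<Rightarrow>
      S \<in> \<T> \<and> \<T>' \<subseteq> \<T> \<and> infinite \<T>' \<and> (\<forall>S'\<in>\<T>'. (p \<in> S') \<noteq> (p \<in> S)))"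
    for \<T> :: "'b set set" and z :: "'b \<times> 'b set \<times> 'b set set"
  have R: "\<exists>z. R \<T> z" if inf: "infinite \<T>" for \<T>
  proof -
    obtain p S \<T>' where "S \<in> \<T> \<and> \<T>' \<subseteq> \<T> \<and> infinite \<T>' \<and> (\<forall>S'\<in>\<T>'. (p \<in> S') \<noteq> (p \<in> S))"
      using step[OF inf] by blast
    then show ?thesis unfolding R_def by (intro exI[of _ "(p, S, \<T>')"]) simp
  qed
  have "\<exists>z. \<forall>n. (infinite (snd (snd (z n))) \<and> snd (snd (z n)) \<subseteq> \<S>) \<and> R (snd (snd (z n))) (z (Suc n))"
  proof (rule dependent_nat_choice)
    show "\<exists>x. infinite (snd (snd x)) \<and> snd (snd x) \<subseteq> \<S>"
      using assms by (intro exI[of _ "(undefined, undefined, \<S>)"]) simp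
  next
    fix x :: "'b \<times> 'b set \<times> 'b set set" and n :: nat
    assume x: "infinite (snd (snd x)) \<and> snd (snd x) \<subseteq> \<S>"
    then obtain z where z: "R (snd (snd x)) z" using R by blast
    then show "\<exists>y. (infinite (snd (snd y)) \<and> snd (snd y) \<subseteq> \<S>) \<and> R (snd (snd x)) y"
      using x by (intro exI[of _ z]) (auto simp: R_def split: prod.splits)
  qed
  then obtain z where z: "\<And>n. snd (snd (z n)) \<subseteq> \<S>" "\<And>n. R (snd (snd (z n))) (z (Suc n))"
    by blast
  define T where "T n = snd (snd (z n))" for n
  define S where "S n = fst (snd (z (Suc n)))" for n
  define q where "q n = fst (z (Suc n))" for n
  have S: "S n \<in> T n" "T (Suc n) \<subseteq> T n" and sep: "\<forall>S'\<in>T (Suc n). (q n \<in> S') \<noteq> (q n \<in> S n)" for n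
    using z(2)[of n] unfolding R_def T_def S_def q_def by (auto split: prod.splits)
  have anti: "m \<le> n \<Longrightarrow> T n \<subseteq> T m" for m n
    by (rule lift_Suc_antimono_le[of T]) (use S in auto)
  have later: "(q n \<in> S m) \<noteq> (q n \<in> S n)" if "n < m" for n m
    using sep[of n] anti[of "Suc n" m] S(1)[of m] that by auto
  have SS: "S n \<in> \<S>" for n using S(1)[of n] z(1)[of n] by (auto simp: T_def)
  obtain g :: "nat \<Rightarrow> nat" and c where g: "strict_mono g"
    and c: "\<And>m n. m < n \<Longrightarrow> ((q (g n) \<in> S (g m)) = (q (g n) \<in> S (g n))) = c"
    by (rule homogeneous_subsequence[where P="\<lambda>m n. (q n \<in> S m) = (q n \<in> S n)"]) blast
  have *: "((q (g n) \<in> S (g m)) = (q (g n) \<in> S (g n))) \<longleftrightarrow> (if m < n then c else m = n)" for m n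
    using c[of m n] later[of "g n" "g m"] g
    by (cases m n rule: linorder_cases) (auto simp: strict_mono_less)
  show thesis
  proof (rule that[of "\<lambda>j. S (g (2*j))" "\<lambda>j. S (g (2*j+1))" "\<lambda>i. q (g (2*i))"])
    fix i j :: nat
    show "((q (g (2*i)) \<in> S (g (2*j))) \<noteq> (q (g (2*i)) \<in> S (g (2*j+1)))) = (i = j)"
      using *[of "2*i" "2*j"] *[of "2*i" "2*j+1"]
      by (cases i j rule: linorder_cases; cases c) (auto split: if_splits)
  qed (use SS in auto)
qed

section \<open>Translates in a divisible ordered group\<close>

definition multiple :: "nat \<Rightarrow> 'a::ab_group_add \<Rightarrow> 'a" where
  "multiple n x = (\<Sum>i<n. x)"

lemma multiple_simps [simp]: "multiple 0 x = 0" "multiple (Suc n) x = multiple n x + x"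
  by (simp_all add: multiple_def)

lemma multiple_add: "multiple (m + n) x = multiple m x + multiple n x"
  by (induction m) (simp_all add: algebra_simps)

lemma multiple_multiple: "multiple m (multiple n x) = multiple (m * n) x"
  by (induction m) (simp_all add: multiple_add algebra_simps)

lemma multiple_less:
  fixes x :: "'a::linordered_ab_group_add"
  assumes "0 < x" "m < n" shows "multiple m x < multiple n x"
proof -
  have "strict_mono (\<lambda>n. multiple n x)" by (simp add: strict_mono_Suc_iff assms(1))
  then show ?thesis using assms(2) by (rule strict_monoD)
qed

text \<open>If there were only \<open>k\<close> translates, divide \<open>y - x\<close> into \<open>(k + 1)!\<close> steps of length \<open>m\<close>. Two of the
translates by \<open>m, 2m, \<dots>, (k + 1)m\<close> coincide, so \<open>jm\<close> is a local period of \<open>Q\<close> for some \<open>j \<le> k\<close>. It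
divides \<open>y - x\<close>, so \<open>Q\<close> contains both or none of \<open>x\<close> and \<open>y\<close>. The condition \<open>y - x < x\<close> keeps the
walk from \<open>x\<close> to \<open>y\<close> in the region where the coinciding translates say something about \<open>Q\<close>: they are
compared on \<open>(0, \<eta>)\<close> only.\<close>
lemma infinitely_many_translates:
  fixes Q :: "'a::linordered_ab_group_add set"
  assumes div: "divisible TYPE('a)"
    and xy: "0 < x" "x < y" "y < \<eta>" "y - x < x" and Q: "(x \<in> Q) \<noteq> (y \<in> Q)"
  shows "infinite ((\<lambda>c. {s. 0 < s \<and> s < \<eta> \<and> s + c \<in> Q}) ` {0<..<\<eta>})"
proof
  define S where "S c = {s. 0 < s \<and> s < \<eta> \<and> s + c \<in> Q}" for c
  assume "finite ((\<lambda>c. {s. 0 < s \<and> s < \<eta> \<and> s + c \<in> Q}) ` {0<..<\<eta>})"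
  then have fin: "finite (S ` {0<..<\<eta>})" by (simp add: S_def)
  define K where "K = Suc (card (S ` {0<..<\<eta>}))"
  obtain m where m: "multiple (fact K) m = y - x"
    using div unfolding divisible_def multiple_def by (metis fact_gt_zero)
  have "0 < m"
  proof (rule ccontr)
    assume "\<not> 0 < m"
    then have "multiple (fact K) m \<le> 0" unfolding multiple_def by (intro sum_nonpos) auto
    then show False using m xy by simp
  qed
  have range: "0 < multiple i m \<and> multiple i m \<le> y - x" if "i \<in> {1..K}" for i
  proof -
    have "i \<le> fact K" using that fact_ge_self[of K] by auto
    then have "multiple i m \<le> multiple (fact K) m"
      using multiple_less[OF \<open>0 < m\<close>, of i "fact K"] by (cases "i = fact K") auto
    then show ?thesis using multiple_less[OF \<open>0 < m\<close>, of 0 i] that m by auto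
  qed
  have xe: "y - x < \<eta>" using xy by order
  have sub: "(\<lambda>i. S (multiple i m)) ` {1..K} \<subseteq> S ` {0<..<\<eta>}"
  proof
    fix A assume "A \<in> (\<lambda>i. S (multiple i m)) ` {1..K}"
    then obtain i where i: "i \<in> {1..K}" "A = S (multiple i m)" by blast
    have "multiple i m < \<eta>" using range[OF i(1)] xe by (meson le_less_trans)
    then show "A \<in> S ` {0<..<\<eta>}" using range[OF i(1)] i(2) by auto
  qed
  then have "card ((\<lambda>i. S (multiple i m)) ` {1..K}) < card {1..K}"
    using card_mono[OF fin sub] by (simp add: K_def)
  then have "\<not> inj_on (\<lambda>i. S (multiple i m)) {1..K}" using pigeonhole by blast
  then obtain i i' where ii: "i \<in> {1..K}" "i' \<in> {1..K}" "i < i'" "S (multiple i m) = S (multiple i' m)"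
    unfolding inj_on_def by (metis linorder_neqE_nat)
  define j where "j = i' - i"
  define h where "h = multiple j m"
  have h: "multiple i' m = multiple i m + h" using ii(3) multiple_add[of i j m] by (simp add: j_def h_def)
  have j: "1 \<le> j" "j \<le> K" using ii by (auto simp: j_def)
  have "j dvd fact K" using j by (rule dvd_fact)
  then obtain r where r: "fact K = r * j" by (metis dvd_div_mult_self)
  have total: "multiple r h = y - x" using m r by (simp add: h_def multiple_multiple)
  have "0 < h" using multiple_less[OF \<open>0 < m\<close>, of 0 j] j by (simp add: h_def)
  have "x + multiple l h \<in> Q \<longleftrightarrow> x \<in> Q" if "l \<le> r" for l
    using that
  proof (induction l)
    case (Suc l)
    define w where "w = x + multiple l h"
    have "x \<le> w" using multiple_less[OF \<open>0 < h\<close>, of 0 l] by (cases l) (auto simp: w_def)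
    have "multiple l h < y - x" using multiple_less[OF \<open>0 < h\<close>, of l r] Suc.prems total by simp
    then have "w < y" by (simp add: w_def algebra_simps)
    define s where "s = w - multiple i m"
    have "multiple i m < w" using range[OF ii(1)] xy \<open>x \<le> w\<close> by (meson le_less_trans less_le_trans)
    then have "0 < s" by (simp add: s_def)
    moreover have "s < w" using range[OF ii(1)] by (simp add: s_def)
    ultimately have s: "0 < s" "s < \<eta>" using \<open>w < y\<close> xy by auto
    have sw: "s + multiple i m = w" by (simp add: s_def)
    have "w \<in> Q \<longleftrightarrow> s \<in> S (multiple i m)" using s sw by (simp add: S_def)
    also have "\<dots> \<longleftrightarrow> s \<in> S (multiple i' m)" using ii(4) by simp
    also have "\<dots> \<longleftrightarrow> s + multiple i' m \<in> Q" using s by (simp add: S_def)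
    also have "s + multiple i' m = w + h" using sw by (simp add: h add.assoc[symmetric])
    finally have "w \<in> Q \<longleftrightarrow> w + h \<in> Q" .
    then show ?case using Suc by (simp add: w_def algebra_simps)
  qed simp
  from this[of r] show False using Q total by simp
qed

section \<open>Patterns in a short interval\<close>

text \<open>In order-theoretic terms, \<open>0\<close> has uncountable coinitiality from the right.\<close>
definition countable_sets_bounded_off_zero :: "'a::linordered_ab_group_add itself \<Rightarrow> bool" where
  "countable_sets_bounded_off_zero TYPE('a) \<longleftrightarrow>
    (\<forall>A :: 'a set. countable A \<longrightarrow> (\<forall>a\<in>A. 0 < a) \<longrightarrow> (\<exists>e>0. \<forall>a\<in>A. e < a))"

text \<open>An ict-pattern with two rows realized in \<open>(0, \<epsilon>)\<close>. Only the first \<open>n\<close> formulas of each row are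
controlled at a time, since consistency is finite satisfiability. The second row uses symmetric
differences of translates because \<open>infinite_family_diagonal\<close> produces pairs of sets.\<close>
definition local_pattern ::
  "'a::linordered_ab_group_add set \<Rightarrow> 'a \<Rightarrow> (nat \<Rightarrow> 'a) \<Rightarrow> (nat \<Rightarrow> 'a) \<Rightarrow> (nat \<Rightarrow> 'a) \<Rightarrow> (nat \<Rightarrow> 'a) \<Rightarrow> bool"
  where "local_pattern X \<epsilon> p q b c \<longleftrightarrow>
    (\<forall>i k n. \<exists>t. 0 < t \<and> t < \<epsilon> \<and> (\<forall>j<n. p j < t \<and> t < q j \<longleftrightarrow> j = i) \<and>
      (\<forall>j<n. (t + b j \<in> X) \<noteq> (t + c j \<in> X) \<longleftrightarrow> j = k))"

lemma family_bounded_off_zero: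
  fixes a :: "'i::countable \<Rightarrow> 'a::linordered_ab_group_add"
  assumes "countable_sets_bounded_off_zero TYPE('a)" "\<And>i. 0 < a i"
  obtains e where "0 < e" "\<And>i. e < a i"
proof -
  have "countable (range a)" "\<forall>x\<in>range a. 0 < x" using assms(2) by auto
  then obtain e where "0 < e" "\<forall>x\<in>range a. e < x"
    using assms(1) unfolding countable_sets_bounded_off_zero_def by blast
  then show thesis using that by blast
qed

text \<open>Each finite Boolean combination of the translates either misses some interval \<open>(0, e)\<close> or has
points arbitrarily close to \<open>0\<close>. There are countably many of them, so one \<open>e\<^sub>0\<close> serves all: a
combination that meets \<open>(0, e\<^sub>0)\<close> at all has points arbitrarily close to \<open>0\<close>. Therefore the
points that separate the translates can be moved as close to \<open>0\<close> as needed, and the intervals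
of the first row can be chosen one below the other, each long enough to contain witnesses for
all formulas of the second row.\<close>
lemma pattern_of_distinct_germs:
  fixes X :: "'a::linordered_ab_group_add set" and b :: "nat \<Rightarrow> 'a"
  assumes bdd: "countable_sets_bounded_off_zero TYPE('a)" and "0 < \<epsilon>"
    and germs: "\<And>i j e. i < j \<Longrightarrow> 0 < e \<Longrightarrow> \<exists>t. 0 < t \<and> t < e \<and> (t + b i \<in> X) \<noteq> (t + b j \<in> X)"
  shows "\<exists>p q b c. local_pattern X \<epsilon> p q b c"
proof -
  \<comment> \<open>\<open>At w\<close> is the Boolean combination of the first \<open>length w\<close> translates with sign vector \<open>w\<close>.\<close>
  define At where "At w = {t. \<forall>j<length w. (t + b j \<in> X) = w ! j}" for w :: "bool list"
  have "\<exists>e>0. (\<exists>t\<in>At w. 0 < t \<and> t < e) \<longrightarrow> (\<forall>d>0. \<exists>t\<in>At w. 0 < t \<and> t < d)" for w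
    using assms(2) by blast
  then obtain e where e: "\<And>w. 0 < e w"
    and acc: "\<And>w d t. t \<in> At w \<Longrightarrow> 0 < t \<Longrightarrow> t < e w \<Longrightarrow> 0 < d \<Longrightarrow> \<exists>t\<in>At w. 0 < t \<and> t < d"
    by metis
  obtain e' where e': "0 < e'" "\<And>w. e' < e w"
    using family_bounded_off_zero[OF bdd, of e] e by blast
  define e0 where "e0 = min e' \<epsilon>"
  have e0: "0 < e0" "\<And>w. e0 < e w" "e0 \<le> \<epsilon>" using e' assms(2) by (auto simp: e0_def min.strict_coboundedI1)
  define S where "S j = {t. 0 < t \<and> t < e0 \<and> t + b j \<in> X}" for j
  have "S i \<noteq> S j" if "i < j" for i j
    using germs[OF that e0(1)] by (auto simp: S_def)
  then have "inj S" unfolding inj_on_def by (metis linorder_neqE_nat)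
  then have "infinite (range S)" using finite_imageD by blast
  then obtain A B and p :: "nat \<Rightarrow> 'a" where AB: "range A \<subseteq> range S" "range B \<subseteq> range S"
    and p: "\<And>i j. (p i \<in> A j) \<noteq> (p i \<in> B j) \<longleftrightarrow> i = j"
    by (rule infinite_family_diagonal) blast
  obtain \<alpha> \<beta> where ab: "\<And>j. A j = S (\<alpha> j)" "\<And>j. B j = S (\<beta> j)"
    using AB by (auto simp: image_subset_iff image_iff Bex_def dest!: choice)
  have p0: "0 < p i \<and> p i < e0" for i using p[of i i] unfolding ab S_def by blast
  have diag: "(p i + b (\<alpha> j) \<in> X) \<noteq> (p i + b (\<beta> j) \<in> X) \<longleftrightarrow> i = j" for i j
    using p[of i j] p0[of i] unfolding ab S_def by blast
  \<comment> \<open>Only finitely many translates matter, so \<open>p i\<close> may be replaced by a point near \<open>0\<close> with the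
     same sign vector.\<close>
  have near0: "\<exists>t. 0 < t \<and> t < d \<and> (\<forall>j<n. (t + b (\<alpha> j) \<in> X) \<noteq> (t + b (\<beta> j) \<in> X) \<longleftrightarrow> i = j)"
    if "0 < d" for i n d
  proof -
    define N where "N = Suc (Max (insert 0 (\<alpha> ` {..<n} \<union> \<beta> ` {..<n})))"
    have N: "\<alpha> j < N" "\<beta> j < N" if "j < n" for j
      unfolding N_def less_Suc_eq_le using that by (auto intro!: Max_ge)
    define w where "w = map (\<lambda>j. p i + b j \<in> X) [0..<N]"
    have "p i \<in> At w" by (simp add: At_def w_def)
    moreover have "p i < e w" using p0 e0(2) less_trans by blast
    ultimately obtain t where t: "t \<in> At w" "0 < t" "t < d"
      using acc[OF _ conjunct1[OF p0[of i]] _ \<open>0 < d\<close>] by blast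
    have "(t + b j \<in> X) = (p i + b j \<in> X)" if "j < N" for j
      using t(1) that by (simp add: At_def w_def)
    then show ?thesis using t diag[of i] N by (intro exI[of _ t]) auto
  qed
  have "\<exists>f. \<forall>k. (0 < f k \<and> f k \<le> e0) \<and> (f (Suc k) < f k \<and>
      (\<forall>i n. \<exists>t. f (Suc k) < t \<and> t < f k \<and>
          (\<forall>j<n. (t + b (\<alpha> j) \<in> X) \<noteq> (t + b (\<beta> j) \<in> X) \<longleftrightarrow> i = j)))"
  proof (rule dependent_nat_choice)
    show "\<exists>x. 0 < x \<and> x \<le> e0" using e0 by blast
  next
    fix x :: 'a and k :: nat
    assume x: "0 < x \<and> x \<le> e0"
    have "\<forall>z. \<exists>t. 0 < t \<and> t < x \<and>
        (\<forall>j<snd z. (t + b (\<alpha> j) \<in> X) \<noteq> (t + b (\<beta> j) \<in> X) \<longleftrightarrow> fst z = j)"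
      using near0[OF conjunct1[OF x]] by simp
    from choice[OF this] obtain t where t: "\<forall>z. 0 < t z \<and> t z < x \<and>
        (\<forall>j<snd z. (t z + b (\<alpha> j) \<in> X) \<noteq> (t z + b (\<beta> j) \<in> X) \<longleftrightarrow> fst z = j)"
      by (elim exE)
    have "0 < t z" for z using t by blast
    then obtain y where y: "0 < y" "\<And>z. y < t z"
      using family_bounded_off_zero[OF bdd, of t] by blast
    have "y < x" using y(2)[of "(0, 0)"] t by (meson less_trans)
    moreover have "\<exists>s. y < s \<and> s < x \<and>
          (\<forall>j<n. (s + b (\<alpha> j) \<in> X) \<noteq> (s + b (\<beta> j) \<in> X) \<longleftrightarrow> i = j)" for i n
      using spec[OF t, of "(i, n)"] y(2)[of "(i, n)"] by (intro exI[of _ "t (i, n)"]) simp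
    moreover have "y \<le> e0" using \<open>y < x\<close> x by (meson less_imp_le less_le_trans)
    ultimately show "\<exists>y. (0 < y \<and> y \<le> e0) \<and> (y < x \<and>
      (\<forall>i n. \<exists>t. y < t \<and> t < x \<and>
          (\<forall>j<n. (t + b (\<alpha> j) \<in> X) \<noteq> (t + b (\<beta> j) \<in> X) \<longleftrightarrow> i = j)))"
      using y(1) by (intro exI[of _ y]) simp
  qed
  then obtain f where f: "\<And>k. 0 < f k" "\<And>k. f k \<le> e0" "\<And>k. f (Suc k) < f k"
    and ft: "\<And>k i n. \<exists>t. f (Suc k) < t \<and> t < f k \<and>
          (\<forall>j<n. (t + b (\<alpha> j) \<in> X) \<noteq> (t + b (\<beta> j) \<in> X) \<longleftrightarrow> i = j)"
    by metis
  have dec: "j \<le> k \<Longrightarrow> f k \<le> f j" for j k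
    using lift_Suc_antimono_le[of f j k] f(3) by (auto intro: less_imp_le)
  have "local_pattern X \<epsilon> (\<lambda>k. f (Suc k)) f (\<lambda>j. b (\<alpha> j)) (\<lambda>j. b (\<beta> j))"
    unfolding local_pattern_def
  proof (intro allI)
    fix i k n
    obtain t where t: "f (Suc i) < t" "t < f i"
      "\<And>j. j < n \<Longrightarrow> (t + b (\<alpha> j) \<in> X) \<noteq> (t + b (\<beta> j) \<in> X) \<longleftrightarrow> k = j"
      using ft[of i n k] by blast
    have "f (Suc j) < t \<and> t < f j \<longleftrightarrow> j = i" for j
      using dec[of "Suc j" i] dec[of "Suc i" j] t(1,2)
      by (cases j i rule: linorder_cases) auto
    moreover have "0 < t" "t < \<epsilon>" using t f(1)[of "Suc i"] f(2)[of i] e0(3) by order+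
    ultimately show "\<exists>t. 0 < t \<and> t < \<epsilon> \<and> (\<forall>j<n. f (Suc j) < t \<and> t < f j \<longleftrightarrow> j = i) \<and>
      (\<forall>j<n. (t + b (\<alpha> j) \<in> X) \<noteq> (t + b (\<beta> j) \<in> X) \<longleftrightarrow> j = k)"
      using t(3) by (intro exI[of _ t]) auto
  qed
  then show ?thesis by blast
qed

text \<open>The offset is \<open>t = (b\<^sub>i - u) + s\<close>. Whether \<open>t + u + c\<close> lies in \<open>X\<close> does not depend on \<open>i\<close> as
long as \<open>0 < s + c < \<delta>\<close>, because \<open>X\<close> looks alike above all \<open>b\<^sub>i\<close>; so the choice of an interval and the
choice of a translate are independent.\<close>
lemma pattern_of_equal_germs:
  fixes X :: "'a::{linordered_ab_group_add, dense_linorder} set" and b :: "nat \<Rightarrow> 'a"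
  assumes bdd: "countable_sets_bounded_off_zero TYPE('a)" and div: "divisible TYPE('a)"
    and b: "inj b" "\<And>i. u < b i" "\<And>i. b i < u + \<epsilon>"
    and germs: "\<And>i. \<exists>e>0. \<forall>t. 0 < t \<longrightarrow> t < e \<longrightarrow> (t + b i \<in> X) = (t + b 0 \<in> X)"
    and acc: "\<And>e. 0 < e \<Longrightarrow> \<exists>t. 0 < t \<and> t < e \<and> t + b 0 \<in> X"
    and codense: "\<And>x y. u < x \<Longrightarrow> x < y \<Longrightarrow> y < u + \<epsilon> \<Longrightarrow> \<exists>z. x < z \<and> z < y \<and> z \<notin> X"
  shows "\<exists>p q b c. local_pattern X \<epsilon> p q b c"
proof -
  obtain e1 where e1: "\<And>i. 0 < e1 i"
    "\<And>i t. 0 < t \<Longrightarrow> t < e1 i \<Longrightarrow> (t + b i \<in> X) = (t + b 0 \<in> X)"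
    using germs by metis
  obtain d1 where d1: "0 < d1" "\<And>i. d1 < e1 i" using family_bounded_off_zero[OF bdd, of e1] e1(1) by blast
  have "0 < u + \<epsilon> - b i" for i using b(3)[of i] by simp
  then obtain d2 where d2: "0 < d2" "\<And>i. d2 < u + \<epsilon> - b i" using family_bounded_off_zero[OF bdd, of "\<lambda>i. u + \<epsilon> - b i"] by blast
  \<comment> \<open>The common \<open>\<delta>\<close> must also be below all distances \<open>b i - b j\<close>, so that the intervals above the
     \<open>b i\<close> are disjoint; the value \<open>d1\<close> is a dummy for pairs in the wrong order.\<close>
  define gap where "gap z = (case z of (i, j) \<Rightarrow> if b j < b i then b i - b j else d1)" for z
  have "0 < gap z" for z using d1(1) by (simp add: gap_def split: prod.splits)
  then obtain d3 where d3: "0 < d3" "\<And>z. d3 < gap z" using family_bounded_off_zero[OF bdd, of gap] by blast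
  define \<delta> where "\<delta> = min d1 (min d2 d3)"
  have d: "0 < \<delta>" using d1 d2 d3 by (simp add: \<delta>_def)
  have dX: "(t + b i \<in> X) = (t + b 0 \<in> X)" if "0 < t" "t < \<delta>" for i t
    using e1(2)[of t i] d1(2)[of i] that by (auto simp: \<delta>_def)
  have dr: "b i + \<delta> < u + \<epsilon>" for i
  proof -
    have "\<delta> \<le> d2" by (simp add: \<delta>_def min.coboundedI2)
    then have "\<delta> < u + \<epsilon> - b i" using d2(2)[of i] by order
    then show ?thesis by (simp add: algebra_simps)
  qed
  have dsep: "b j + \<delta> < b i" if "b j < b i" for i j
  proof -
    have "\<delta> \<le> d3" by (simp add: \<delta>_def min.coboundedI2)
    then have "\<delta> < b i - b j" using d3(2)[of "(i, j)"] that by (simp add: gap_def)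
    then show ?thesis by (simp add: algebra_simps)
  qed
  \<comment> \<open>Both the point \<open>s\<close> and the translation \<open>c\<close> range over \<open>(0, \<eta>)\<close>, and their sum must stay
     below \<open>\<delta>\<close>.\<close>
  obtain \<eta> where eta: "0 < \<eta>" "\<eta> + \<eta> \<le> \<delta>"
  proof -
    obtain h where h: "0 < h" "h < \<delta>" using dense d by blast
    show thesis
    proof (cases "h + h \<le> \<delta>")
      case True then show ?thesis using that h by blast
    next
      case False
      then have "(\<delta> - h) + (\<delta> - h) \<le> \<delta>" by (simp add: algebra_simps)
      then show ?thesis using that[of "\<delta> - h"] h by simp
    qed
  qed
  have etad: "\<eta> < \<delta>" using eta by (metis add_less_same_cancel1 less_le_trans linorder_not_le less_add_same_cancel1)
  define Q where "Q = {t. t + b 0 \<in> X}"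
  obtain x where x: "0 < x" "x < \<eta>" "x \<in> Q" using acc[OF eta(1)] by (auto simp: Q_def)
  \<comment> \<open>A point outside \<open>Q\<close> is needed between \<open>x\<close> and \<open>x + x\<close>, to meet the closeness condition of
     \<open>infinitely_many_translates\<close>.\<close>
  define m where "m = min \<eta> (x + x)"
  have xm: "x < m" "m \<le> \<eta>" "m \<le> x + x" using x by (auto simp: m_def)
  have "u < x + b 0" using b(2)[of 0] x(1) by (metis add.commute add_strict_increasing less_imp_le)
  moreover have "m + b 0 < u + \<epsilon>"
  proof -
    have "m < \<delta>" using xm(2) etad by order
    then have "m + b 0 < b 0 + \<delta>" by simp
    then show ?thesis using dr[of 0] by order
  qed
  ultimately obtain z where z: "x + b 0 < z" "z < m + b 0" "z \<notin> X"
    using codense[of "x + b 0" "m + b 0"] xm(1) by auto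
  define y where "y = z - b 0"
  have y: "x < y" "y < m" "y \<notin> Q" using z by (auto simp: y_def Q_def algebra_simps)
  have "y < \<eta>" using y xm by order
  have "y < x + x" using y xm by order
  then have "y - x < x" by (simp add: algebra_simps)
  define S where "S c = {s. 0 < s \<and> s < \<eta> \<and> s + c \<in> Q}" for c
  have "infinite (S ` {0<..<\<eta>})"
    unfolding S_def using infinitely_many_translates[OF div x(1) y(1) \<open>y < \<eta>\<close> \<open>y - x < x\<close>, of Q] x y by blast
  then obtain A B and p :: "nat \<Rightarrow> 'a"
    where AB: "range A \<subseteq> S ` {0<..<\<eta>}" "range B \<subseteq> S ` {0<..<\<eta>}"
    and p: "\<And>i j. (p i \<in> A j) \<noteq> (p i \<in> B j) \<longleftrightarrow> i = j"
    by (rule infinite_family_diagonal) blast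
  have "A j \<in> S ` {0<..<\<eta>}" "B j \<in> S ` {0<..<\<eta>}" for j using AB by blast+
  then have "\<forall>j. \<exists>c. A j = S c \<and> 0 < c \<and> c < \<eta>" "\<forall>j. \<exists>c. B j = S c \<and> 0 < c \<and> c < \<eta>"
    by (simp_all add: image_iff Bex_def) blast+
  then obtain \<alpha> \<beta> where \<alpha>: "\<And>j. A j = S (\<alpha> j)" "\<And>j. 0 < \<alpha> j" "\<And>j. \<alpha> j < \<eta>"
    and \<beta>: "\<And>j. B j = S (\<beta> j)" "\<And>j. 0 < \<beta> j" "\<And>j. \<beta> j < \<eta>" by metis
  have p0: "0 < p i" "p i < \<eta>" for i using p[of i i] unfolding \<alpha> \<beta> S_def by blast+
  have shift: "(b i - u + p k) + (u + c) \<in> X \<longleftrightarrow> p k \<in> S c" if "0 < c" "c < \<eta>" for i k c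
  proof -
    have "0 < p k + c" "p k + c < \<eta> + \<eta>" using p0[of k] that by (auto intro: add_strict_mono add_pos_pos)
    then have "(p k + c) + b i \<in> X \<longleftrightarrow> p k + c \<in> Q"
      using dX[of "p k + c" i] eta(2) by (auto simp: Q_def)
    then show ?thesis using p0[of k] by (simp add: S_def algebra_simps)
  qed
  have "local_pattern X \<epsilon> (\<lambda>i. b i - u) (\<lambda>i. b i - u + \<delta>) (\<lambda>j. u + \<alpha> j) (\<lambda>j. u + \<beta> j)"
    unfolding local_pattern_def
  proof (intro allI)
    fix i k n
    let ?t = "b i - u + p k"
    have pk: "0 < p k" "p k < \<delta>" using p0[of k] etad by auto
    have "0 < ?t" using b(2)[of i] pk by (simp add: add_pos_pos)
    moreover have "?t < \<epsilon>" using dr[of i] pk by (simp add: algebra_simps) (metis add.commute add_strict_left_mono less_trans)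
    moreover have "b j - u < ?t \<and> ?t < b j - u + \<delta> \<longleftrightarrow> j = i" for j
    proof (cases "j = i")
      case False
      show ?thesis
      proof (cases "b j < b i")
        case True
        then have "b j + \<delta> < b i" by (rule dsep)
        then have "b j + \<delta> < b i + p k" using pk by (simp add: add_strict_increasing2 less_trans)
        then show ?thesis using False by (auto simp: algebra_simps dest: less_asym)
      next
        case nless: False
        then have "b i < b j" using False b(1) by (metis inj_eq linorder_neqE)
        then have "b i + \<delta> < b j" by (rule dsep)
        moreover have "b i + p k < b i + \<delta>" using pk by simp
        ultimately have "b i + p k < b j" by order
        then show ?thesis using False by (auto simp: algebra_simps dest: less_asym)
      qed
    qed (use pk in auto)
    moreover have "(?t + (u + \<alpha> j) \<in> X) \<noteq> (?t + (u + \<beta> j) \<in> X) \<longleftrightarrow> j = k" for j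
      using p[of k j] \<alpha> \<beta> by (simp only: shift) auto
    ultimately show "\<exists>t. 0 < t \<and> t < \<epsilon> \<and> (\<forall>j<n. b j - u < t \<and> t < b j - u + \<delta> \<longleftrightarrow> j = i) \<and>
        (\<forall>j<n. (t + (u + \<alpha> j) \<in> X) \<noteq> (t + (u + \<beta> j) \<in> X) \<longleftrightarrow> j = k)" by blast
  qed
  then show ?thesis by blast
qed

text \<open>Ramsey's theorem reduces the general case to the two cases above.\<close>
lemma pattern_of_accumulation:
  fixes X B :: "'a::{linordered_ab_group_add, dense_linorder} set"
  assumes bdd: "countable_sets_bounded_off_zero TYPE('a)" and div: "divisible TYPE('a)"
    and "0 < \<epsilon>" and B: "infinite B" "B \<subseteq> {u<..<u + \<epsilon>}"
    and acc: "\<And>b e. b \<in> B \<Longrightarrow> 0 < e \<Longrightarrow> \<exists>t. 0 < t \<and> t < e \<and> t + b \<in> X"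
    and codense: "\<And>x y. u < x \<Longrightarrow> x < y \<Longrightarrow> y < u + \<epsilon> \<Longrightarrow> \<exists>z. x < z \<and> z < y \<and> z \<notin> X"
  shows "\<exists>p q b c. local_pattern X \<epsilon> p q b c"
proof -
  obtain b :: "nat \<Rightarrow> 'a" where b: "inj b" "range b \<subseteq> B"
    using B(1) infinite_countable_subset by blast
  define same where "same i j \<longleftrightarrow> (\<exists>e>0. \<forall>t. 0 < t \<longrightarrow> t < e \<longrightarrow> (t + b i \<in> X) = (t + b j \<in> X))" for i j
  obtain g :: "nat \<Rightarrow> nat" and c where g: "strict_mono g" and c: "\<And>m n. m < n \<Longrightarrow> same (g m) (g n) \<longleftrightarrow> c"
    by (rule homogeneous_subsequence[of same]) blast
  show ?thesis
  proof (cases c)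
    case False
    show ?thesis
      by (rule pattern_of_distinct_germs[OF bdd \<open>0 < \<epsilon>\<close>, of "\<lambda>n. b (g n)"])
        (use c False in \<open>auto simp: same_def\<close>)
  next
    case True
    have in_B: "b (g i) \<in> B" for i using b(2) by blast
    show ?thesis
    proof (rule pattern_of_equal_germs[OF bdd div, of "\<lambda>n. b (g n)" u])
      show "inj (\<lambda>n. b (g n))"
        using inj_compose[OF b(1) strict_mono_imp_inj_on[OF g]] by (simp add: comp_def)
      show "u < b (g i)" "b (g i) < u + \<epsilon>" for i using in_B[of i] B(2) by auto
      show "\<exists>e>0. \<forall>t. 0 < t \<longrightarrow> t < e \<longrightarrow> (t + b (g i) \<in> X) = (t + b (g 0) \<in> X)" for i
      proof (cases i)
        case 0 then show ?thesis using \<open>0 < \<epsilon>\<close> by blast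
      next
        case (Suc j)
        then have "same (g 0) (g i)" using c[of 0 i] True by simp
        then show ?thesis unfolding same_def by blast
      qed
      show "\<exists>t. 0 < t \<and> t < e \<and> t + b (g 0) \<in> X" if "0 < e" for e using acc[OF in_B that] .
    qed (fact codense)
  qed
qed

lemma local_pattern_mono:
  assumes "local_pattern X \<epsilon>' p q b c" "\<epsilon>' \<le> \<epsilon>"
  shows "local_pattern X \<epsilon> p q b c"
  using assms(1) unfolding local_pattern_def
  by (elim all_forward ex_forward conj_forward) (use assms(2) in auto)

section \<open>Saturation\<close>

text \<open>Hence \<open>|T|\<^sup>+\<close>-saturation covers types over countable parameter sets.\<close>
lemma infinite_Th: "infinite (Th L M)"
proof -
  have "inj (\<lambda>n. Ex n (Eq (Var n) (Var n)))" by (auto simp: inj_on_def)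
  moreover have "range (\<lambda>n. Ex n (Eq (Var n) (Var n))) \<subseteq> Th L M" by (auto simp: Th_def)
  ultimately show ?thesis using infinite_iff_countable_subset by blast
qed

text \<open>The type \<open>{0 < x < a | a \<in> A}\<close> is finitely satisfiable by density. The given positive element is
added to \<open>A\<close> so that the type says \<open>0 < x\<close> even if \<open>A\<close> is empty.\<close>
lemma saturated_countable_sets_bounded:
  fixes M :: "('f, 'r, 'a :: {linordered_ab_group_add, dense_linorder}) fo_structure"
  assumes ex: "expands_ordered_group L M" and sat: "saturated L M (cardSuc |Th L M| )"
    and z: "0 < (z::'a)"
  shows "countable_sets_bounded_off_zero TYPE('a)"
  unfolding countable_sets_bounded_off_zero_def
proof (intro allI impI)
  fix A :: "'a set"
  assume A: "countable A" "\<forall>a\<in>A. 0 < a"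
  obtain less where less: "rel_arity L less = 2" "\<And>x y. rel_interp M less [x, y] \<longleftrightarrow> x < y"
    using ex unfolding expands_ordered_group_def by blast
  define \<psi> :: "('f, 'r) fm" where
    "\<psi> = Conj (Rel less [Var 1, Var 0]) (Rel less [Var 0, Var 2])"
  define par where "par a = (\<lambda>_ :: nat. a)(1 := 0)" for a :: 'a
  define \<Sigma> where "\<Sigma> = (\<lambda>a. (\<psi>, par a)) ` insert z A"
  have sat\<psi>: "sat M (override_on (par a) x {0}) \<psi> \<longleftrightarrow> 0 < x 0 \<and> x 0 < a" for a x
    by (simp add: \<psi>_def par_def less override_on_def)
  have "countable (insert 0 (insert z A))" using A by simp
  then have "|insert 0 (insert z A)| \<le>o |UNIV :: nat set|"
    unfolding countable_def using card_of_ordLeq[of "insert 0 (insert z A)" "UNIV :: nat set"] by blast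
  also have "|UNIV :: nat set| \<le>o |Th L M|" using infinite_Th infinite_iff_card_of_nat by blast
  also have "|Th L M| <o cardSuc |Th L M|" by (rule cardSuc_greater[OF card_of_Card_order])
  finally have card: "|insert 0 (insert z A)| <o cardSuc |Th L M|" .
  have "consistent M {0} \<Sigma>"
    unfolding consistent_def
  proof (intro allI impI)
    fix \<Sigma>' assume "\<Sigma>' \<subseteq> \<Sigma>" "finite \<Sigma>'"
    then obtain A' where A': "A' \<subseteq> insert z A" "finite A'" "\<Sigma>' = (\<lambda>a. (\<psi>, par a)) ` A'"
      unfolding \<Sigma>_def by (meson finite_subset_image)
    have "0 < Min (insert z A')" using A' A z by auto
    then obtain x where x: "0 < x" "x < Min (insert z A')" using dense by blast
    have "realizes M {0} (\<lambda>_. x) \<Sigma>'"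
      using x A' unfolding realizes_def by (auto simp: sat\<psi>)
    then show "\<exists>x. realizes M {0} x \<Sigma>'" by blast
  qed
  moreover have "\<forall>(\<phi>, e) \<in> \<Sigma>. wf_fm L \<phi> \<and> e ` (free_vars \<phi> - {0}) \<subseteq> insert 0 (insert z A)"
    by (auto simp: \<Sigma>_def \<psi>_def par_def less)
  ultimately obtain x where "realizes M {0} x \<Sigma>"
    using sat card unfolding saturated_def by (meson finite.emptyI finite.insertI)
  then have "0 < x 0 \<and> x 0 < a" if "a \<in> insert z A" for a
    using that unfolding realizes_def \<Sigma>_def by (simp only: ball_simps prod.case sat\<psi>) blast
  then show "\<exists>e>0. \<forall>a\<in>A. e < a" by blast
qed

section \<open>Dp-rank and the discrete set\<close>

text \<open>The definitions of \<open>X\<close> and of \<open>D\<close> may use the same variables for different parameters. Before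
they are combined into one formula, their variables are moved apart by an injective renaming,
which is applied to bound variables as well.\<close>
primrec rename_term :: "(nat \<Rightarrow> nat) \<Rightarrow> 'f fo_term \<Rightarrow> 'f fo_term" where
  "rename_term r (Var n) = Var (r n)"
| "rename_term r (Fn f ts) = Fn f (map (rename_term r) ts)"

primrec rename_fm :: "(nat \<Rightarrow> nat) \<Rightarrow> ('f, 'r) fm \<Rightarrow> ('f, 'r) fm" where
  "rename_fm r (Eq s t) = Eq (rename_term r s) (rename_term r t)"
| "rename_fm r (Rel R ts) = Rel R (map (rename_term r) ts)"
| "rename_fm r (Neg \<phi>) = Neg (rename_fm r \<phi>)"
| "rename_fm r (Conj \<phi> \<psi>) = Conj (rename_fm r \<phi>) (rename_fm r \<psi>)"
| "rename_fm r (Ex n \<phi>) = Ex (r n) (rename_fm r \<phi>)"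

lemma wf_rename_term: "wf_term L (rename_term r t) \<longleftrightarrow> wf_term L t"
  by (induction t) auto

lemma wf_rename_fm: "wf_fm L (rename_fm r \<phi>) \<longleftrightarrow> wf_fm L \<phi>"
  by (induction \<phi>) (auto simp: wf_rename_term)

lemma term_val_rename: "term_val M e (rename_term r t) = term_val M (\<lambda>n. e (r n)) t"
proof (induction t)
  case (Fn f ts)
  then have "map (term_val M e \<circ> rename_term r) ts = map (term_val M (\<lambda>n. e (r n))) ts" by simp
  then show ?case by (simp del: map_eq_conv)
qed simp

lemma sat_rename:
  assumes "inj r"
  shows "sat M e (rename_fm r \<phi>) \<longleftrightarrow> sat M (\<lambda>n. e (r n)) \<phi>"
proof (induction \<phi> arbitrary: e)
  case (Rel R ts)
  have "map (term_val M e \<circ> rename_term r) ts = map (term_val M (\<lambda>n. e (r n))) ts"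
    by (simp add: term_val_rename)
  then show ?case by (simp del: map_eq_conv)
next
  case (Ex n \<phi>)
  have "(\<lambda>k. (e(r n := a)) (r k)) = (\<lambda>k. e (r k))(n := a)" for a
    using assms by (auto simp: inj_eq)
  then show ?case by (simp add: Ex)
qed (simp_all add: term_val_rename)

text \<open>A criterion for violating the rank bound: it is enough to control the first \<open>n\<close> formulas of
each row, since a finite part of the required type contains only finitely many negations.\<close>
lemma dp_rank_at_mostD:
  fixes a :: "nat \<Rightarrow> nat \<Rightarrow> nat \<Rightarrow> 'a"
  assumes rank: "dp_rank_at_most L M m"
    and wf: "\<And>i. i \<le> m \<Longrightarrow> wf_fm L (\<phi> i)"
    and pat: "\<And>\<eta> n. \<exists>x. \<forall>i\<le>m. sat M ((a i (\<eta> i))(0 := x)) (\<phi> i) \<and>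
        (\<forall>j<n. j \<noteq> \<eta> i \<longrightarrow> \<not> sat M ((a i j)(0 := x)) (\<phi> i))"
  shows False
proof -
  have ov: "override_on e x {0} = e(0 := x 0)" for e x :: "nat \<Rightarrow> 'a"
    by (auto simp: override_on_def)
  have "ict_pattern L M {0} {Eq (Var 0) (Var 0)} {..<Suc m} \<phi> a"
    unfolding ict_pattern_def consistent_def
  proof (intro conjI ballI allI impI)
    show "wf_fm L (\<phi> i)" if "i \<in> {..<Suc m}" for i using wf that by simp
    fix \<eta> :: "nat \<Rightarrow> nat" and \<Sigma>
    assume sub: "\<Sigma> \<subseteq> {Eq (Var 0) (Var 0)} \<times> UNIV \<union> {(\<phi> i, a i (\<eta> i)) |i. i \<in> {..<Suc m}} \<union>
                {(Neg (\<phi> i), a i j) |i j. i \<in> {..<Suc m} \<and> j \<noteq> \<eta> i}" and fin: "finite \<Sigma>"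
    define pos where "pos \<sigma> \<longleftrightarrow> fst \<sigma> = Eq (Var 0) (Var 0) \<or> (\<exists>i\<le>m. \<sigma> = (\<phi> i, a i (\<eta> i)))" for \<sigma>
    define neg where "neg n \<sigma> \<longleftrightarrow> (\<exists>i\<le>m. \<exists>j<n. \<sigma> = (Neg (\<phi> i), a i j) \<and> j \<noteq> \<eta> i)" for n \<sigma>
    have "\<exists>n. pos \<sigma> \<or> neg n \<sigma>" if in_\<Sigma>: "\<sigma> \<in> \<Sigma>" for \<sigma>
    proof -
      consider "\<sigma> \<in> {Eq (Var 0) (Var 0)} \<times> UNIV" | i where "i < Suc m" "\<sigma> = (\<phi> i, a i (\<eta> i))"
        | i j where "i < Suc m" "j \<noteq> \<eta> i" "\<sigma> = (Neg (\<phi> i), a i j)"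
        using subsetD[OF sub in_\<Sigma>] by blast
      then show ?thesis
      proof cases
        case 1 then have "pos \<sigma>" by (auto simp: pos_def) then show ?thesis by blast
      next
        case 2 then have "pos \<sigma>" by (auto simp: pos_def less_Suc_eq_le) then show ?thesis by blast
      next
        case (3 i j) then have "neg (Suc j) \<sigma>" unfolding neg_def
          by (intro exI[of _ i] conjI exI[of _ j]) auto
        then show ?thesis by blast
      qed
    qed
    then obtain f where f: "\<And>\<sigma>. \<sigma> \<in> \<Sigma> \<Longrightarrow> pos \<sigma> \<or> neg (f \<sigma>) \<sigma>" by metis
    define n where "n = Max (insert 0 (f ` \<Sigma>))"
    have n: "pos \<sigma> \<or> neg n \<sigma>" if "\<sigma> \<in> \<Sigma>" for \<sigma>
    proof -
      have "f \<sigma> \<le> n" using that fin unfolding n_def by (intro Max_ge) auto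
      then have "neg (f \<sigma>) \<sigma> \<Longrightarrow> neg n \<sigma>"
        unfolding neg_def by (elim ex_forward conj_forward) auto
      then show ?thesis using f[OF that] by blast
    qed
    obtain x where x: "\<And>i. i \<le> m \<Longrightarrow> sat M ((a i (\<eta> i))(0 := x)) (\<phi> i)"
      "\<And>i j. i \<le> m \<Longrightarrow> j < n \<Longrightarrow> j \<noteq> \<eta> i \<Longrightarrow> \<not> sat M ((a i j)(0 := x)) (\<phi> i)"
      using pat[of \<eta> n] by blast
    have "realizes M {0} (\<lambda>_. x) \<Sigma>"
      unfolding realizes_def
    proof (clarify)
      fix \<psi> e assume "(\<psi>, e) \<in> \<Sigma>"
      from n[OF this] show "sat M (override_on e (\<lambda>_. x) {0}) \<psi>"
      proof
        assume "pos (\<psi>, e)" then show ?thesis using x(1) by (auto simp: pos_def ov)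
      next
        assume "neg n (\<psi>, e)"
        then obtain i j where "i \<le> m" "j < n" "\<psi> = Neg (\<phi> i)" "e = a i j" "j \<noteq> \<eta> i"
          unfolding neg_def by blast
        then show ?thesis using x(2)[of i j] by (simp add: ov)
      qed
    qed
    then show "\<exists>x. realizes M {0} x \<Sigma>" by blast
  qed
  moreover have "models M (Th L M)" by (simp add: models_def Th_def)
  ultimately show False
    using rank unfolding dp_rank_at_most_def dp_rank_less_def by blast
qed

lemma definable_uminus:
  fixes M :: "('f, 'r, 'a :: linordered_ab_group_add) fo_structure"
  assumes ex: "expands_ordered_group L M" and X: "definable L M X"
  shows "definable L M (uminus ` X)"
proof -
  obtain plus where plus: "fun_arity L plus = 2" "\<And>x y. fun_interp M plus [x, y] = x + y"
    using ex unfolding expands_ordered_group_def by blast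
  obtain \<phi> e where phi: "wf_fm L \<phi>" "X = {x. sat M (e(0 := x)) \<phi>}"
    using X unfolding definable_def by blast
  define r where "r n = n + 2" for n :: nat
  define \<psi> where "\<psi> = Ex 2 (Conj (Eq (Fn plus [Var 0, Var 2]) (Var 1)) (rename_fm r \<phi>))"
  define e' where "e' n = (if n = 1 then 0 else e (n - 2))" for n
  have "inj r" by (simp add: inj_on_def r_def)
  have r: "(\<lambda>n. (e'(0 := x, 2 := y)) (r n)) = e(0 := y)" for x y
    by (auto simp: r_def e'_def)
  have "sat M (e'(0 := x)) \<psi> \<longleftrightarrow> (\<exists>y. x + y = 0 \<and> y \<in> X)" for x
  proof -
    have "sat M (e'(0 := x, 2 := y)) (rename_fm r \<phi>) \<longleftrightarrow> y \<in> X" for y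
      by (simp only: sat_rename[OF \<open>inj r\<close>] r phi(2) mem_Collect_eq)
    then show ?thesis by (simp add: \<psi>_def plus e'_def)
  qed
  then have "sat M (e'(0 := x)) \<psi> \<longleftrightarrow> x \<in> uminus ` X" for x
    by (auto simp: image_iff eq_neg_iff_add_eq_0)
  then have "uminus ` X = {x. sat M (e'(0 := x)) \<psi>}" by blast
  moreover have "wf_fm L \<psi>" by (simp add: \<psi>_def wf_rename_fm phi plus)
  ultimately show ?thesis unfolding definable_def by blast
qed

lemma open_contains_interval:
  fixes U :: "'a::{linordered_ab_group_add, linorder_topology} set"
  assumes z: "0 < (z::'a)" and U: "open U" "x \<in> U"
  obtains e where "0 < e" "{x - e<..<x + e} \<subseteq> U"
proof -
  have "x < x + z" "x - z < x" using z by auto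
  obtain b where b: "x < b" "{x..<b} \<subseteq> U" using open_right[OF U \<open>x < x + z\<close>] by blast
  obtain a where a: "a < x" "{a<..x} \<subseteq> U" using open_left[OF U \<open>x - z < x\<close>] by blast
  define e where "e = min (b - x) (x - a)"
  have e: "e \<le> b - x" "e \<le> x - a" by (auto simp: e_def)
  then have "x + e \<le> b" "a \<le> x - e" by (simp_all add: algebra_simps)
  have "y \<in> U" if "x - e < y" "y < x + e" for y
  proof (cases "x \<le> y")
    case True
    have "y < b" using that \<open>x + e \<le> b\<close> by order
    then show ?thesis using True b by auto
  next
    case False
    have "a < y" using that \<open>a \<le> x - e\<close> by order
    then show ?thesis using False a by auto
  qed
  moreover have "0 < e" using a b by (simp add: e_def)
  ultimately show thesis by (intro that[of e]) auto
qed

text \<open>Each of countably many points of \<open>D\<close> is isolated with a radius of its own; a lower bound of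
these radii serves all of them.\<close>
lemma uniformly_separated_sequence:
  fixes D :: "'a::{linordered_ab_group_add, linorder_topology} set"
  assumes bdd: "countable_sets_bounded_off_zero TYPE('a)" and z: "0 < (z::'a)"
    and D: "infinite D" "discrete D"
  obtains d :: "nat \<Rightarrow> 'a" and \<epsilon> where "inj d" "range d \<subseteq> D" "0 < \<epsilon>"
    "\<And>i y. y \<in> D \<Longrightarrow> d i - \<epsilon> < y \<Longrightarrow> y < d i + \<epsilon> \<Longrightarrow> y = d i"
proof -
  obtain d :: "nat \<Rightarrow> 'a" where d: "inj d" "range d \<subseteq> D"
    using D(1) infinite_countable_subset by blast
  have "\<exists>e>0. \<forall>y\<in>D. d i - e < y \<longrightarrow> y < d i + e \<longrightarrow> y = d i" for i
  proof -
    have "d i \<in> D" using d by blast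
    then obtain T where T: "open T" "T \<inter> D = {d i}"
      using D(2) unfolding discrete_def isolated_in_def by blast
    have "d i \<in> T" using T by blast
    obtain e where "0 < e" "{d i - e<..<d i + e} \<subseteq> T"
      using open_contains_interval[OF z T(1) \<open>d i \<in> T\<close>] .
    then show ?thesis using T(2) by (intro exI[of _ e]) auto
  qed
  then obtain e where e: "\<And>i. 0 < e i"
    "\<And>i y. y \<in> D \<Longrightarrow> d i - e i < y \<Longrightarrow> y < d i + e i \<Longrightarrow> y = d i"
    by metis
  obtain \<epsilon> where eps: "0 < \<epsilon>" "\<And>i. \<epsilon> < e i" using family_bounded_off_zero[OF bdd, of e] e(1) by blast
  show thesis
  proof (rule that[OF d eps(1)])
    fix i y assume y: "y \<in> D" "d i - \<epsilon> < y" "y < d i + \<epsilon>"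
    have "d i - e i < d i - \<epsilon>" "d i + \<epsilon> < d i + e i" using eps(2)[of i] by auto
    then show "y = d i" using e(2)[of y i] y by (meson less_trans)
  qed
qed

text \<open>The rows of the forbidden pattern are, for \<open>x\<close> above the separated points of \<open>D\<close>:
\<open>d\<^sub>j < x < d\<^sub>j + \<epsilon>\<close>, and the two rows of the local pattern for the offset \<open>t = x - y\<close>, where \<open>y\<close> is
the point of \<open>D\<close> with \<open>y < x < y + \<epsilon>\<close>. For the \<open>x\<close> in question this \<open>y\<close> is unique and equal to one
of the \<open>d\<^sub>j\<close>, even though \<open>D\<close> may have other points that are not separated.\<close>
lemma no_local_pattern:
  fixes M :: "('f, 'r, 'a :: linordered_ab_group_add) fo_structure"
  assumes ex: "expands_ordered_group L M" and rank: "dp_rank_at_most L M 2"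
    and D: "definable L M D" and X: "definable L M X"
    and d: "inj (d :: nat \<Rightarrow> 'a)" "range d \<subseteq> D"
      "\<And>i y. y \<in> D \<Longrightarrow> d i - \<epsilon> < y \<Longrightarrow> y < d i + \<epsilon> \<Longrightarrow> y = d i"
  shows "\<not> local_pattern X \<epsilon> p q b c"
proof
  assume pattern: "local_pattern X \<epsilon> p q b c"
  obtain less plus where less: "rel_arity L less = 2" "\<And>x y. rel_interp M less [x, y] \<longleftrightarrow> x < y"
    and plus: "fun_arity L plus = 2" "\<And>x y. fun_interp M plus [x, y] = x + y"
    using ex unfolding expands_ordered_group_def by blast
  obtain \<phi>D eD where phiD: "wf_fm L \<phi>D" "D = {x. sat M (eD(0 := x)) \<phi>D}"
    using D unfolding definable_def by blast
  obtain \<phi>X eX where phiX: "wf_fm L \<phi>X" "X = {x. sat M (eX(0 := x)) \<phi>X}"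
    using X unfolding definable_def by blast
  \<comment> \<open>Allocation of variables: \<open>0\<close> is \<open>x\<close>, \<open>1\<close> is \<open>\<epsilon>\<close>, \<open>2\<close> and \<open>3\<close> are the parameters that vary within
     a row, \<open>10\<close> and \<open>11\<close> are the arguments of the formulas for \<open>X\<close> and \<open>D\<close>, and the larger even
     and odd numbers are the remaining variables of these two formulas.\<close>
  define inD where "inD = rename_fm (\<lambda>n. 2*n + 11) \<phi>D"
  define inX where "inX = rename_fm (\<lambda>n. 2*n + 10) \<phi>X"
  define lt :: "'f fo_term \<Rightarrow> 'f fo_term \<Rightarrow> ('f, 'r) fm" where "lt s t = Rel less [s, t]" for s t
  define add where "add s t = Fn plus [s, t]" for s t
  define near where "near \<psi> = Ex 11 (Conj inD (Conj (lt (Var 11) (Var 0))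
      (Conj (lt (Var 0) (add (Var 11) (Var 1))) \<psi>)))" for \<psi>
  \<comment> \<open>\<open>trans k\<close> says that \<open>t + v\<^sub>k \<in> X\<close> for \<open>t = v\<^sub>0 - v\<^bsub>11\<^esub>\<close>, avoiding subtraction, which need not be
     a function symbol.\<close>
  define trans where "trans k = Ex 10 (Conj (Eq (add (Var 10) (Var 11)) (add (Var 0) (Var k))) inX)" for k
  define row where "row i =
    (if i = 0 then Conj (lt (Var 2) (Var 0)) (lt (Var 0) (add (Var 2) (Var 1)))
     else if i = 1 then near (Conj (lt (add (Var 11) (Var 2)) (Var 0)) (lt (Var 0) (add (Var 11) (Var 3))))
     else near (Conj (Neg (Conj (trans 2) (trans 3))) (Neg (Conj (Neg (trans 2)) (Neg (trans 3))))))" for i :: nat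
  define E where "E n = (if n < 10 then \<epsilon> else if even n then eX ((n - 10) div 2) else eD ((n - 11) div 2))" for n :: nat
  define par where "par i j = (if i = 0 then E(2 := d j) else if i = 1 then E(2 := p j, 3 := q j)
      else E(2 := b j, 3 := c j))" for i j :: nat
  have sat_lt: "sat M e (lt s t) \<longleftrightarrow> term_val M e s < term_val M e t" for e s t
    by (simp add: lt_def less)
  have val_add: "term_val M e (add s t) = term_val M e s + term_val M e t" for e s t
    by (simp add: add_def plus)
  have wf_lt: "wf_fm L (lt s t) \<longleftrightarrow> wf_term L s \<and> wf_term L t" for s t
    by (simp add: lt_def less)
  have wf_add: "wf_term L (add s t) \<longleftrightarrow> wf_term L s \<and> wf_term L t" for s t
    by (simp add: add_def plus)
  have wf: "wf_fm L (row i)" for i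
    by (simp add: row_def near_def trans_def wf_lt wf_add inD_def inX_def wf_rename_fm phiD phiX)
  have sat_inD: "sat M e inD \<longleftrightarrow> e 11 \<in> D" if "\<And>n. 11 < n \<Longrightarrow> e n = E n" for e
  proof -
    have "(\<lambda>n. e (2*n + 11)) = eD(0 := e 11)" using that by (auto simp: E_def)
    then show ?thesis by (simp add: inD_def sat_rename inj_on_def phiD)
  qed
  have sat_inX: "sat M e inX \<longleftrightarrow> e 10 \<in> X" if "\<And>n. 11 < n \<Longrightarrow> e n = E n" for e
  proof -
    have "(\<lambda>n. e (2*n + 10)) = eX(0 := e 10)" using that by (auto simp: E_def)
    then show ?thesis by (simp add: inX_def sat_rename inj_on_def phiX)
  qed
  have sat_near: "sat M e (near \<psi>) \<longleftrightarrow>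
      (\<exists>y\<in>D. y < e 0 \<and> e 0 < y + e 1 \<and> sat M (e(11 := y)) \<psi>)"
    if "\<And>n. 11 < n \<Longrightarrow> e n = E n" for e \<psi>
    using that by (simp add: near_def sat_lt val_add sat_inD) blast
  have sat_trans: "sat M e (trans k) \<longleftrightarrow> e 0 - e 11 + e k \<in> X"
    if "\<And>n. 11 < n \<Longrightarrow> e n = E n" "k < 10" for e k
  proof -
    have "w + e 11 = e 0 + e k \<longleftrightarrow> w = e 0 - e 11 + e k" for w by (auto simp: algebra_simps)
    then show ?thesis using that by (simp add: trans_def val_add sat_inX)
  qed
  have E1: "E (Suc 0) = \<epsilon>" by (simp add: E_def)
  show False
  proof (rule dp_rank_at_mostD[OF rank, of row par])
    show "wf_fm L (row i)" for i by (rule wf)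
    fix \<eta> :: "nat \<Rightarrow> nat" and n :: nat
    \<comment> \<open>The bound also exceeds the chosen indices, so that the chosen formulas are satisfied.\<close>
    define N where "N = Suc (n + \<eta> 0 + \<eta> 1 + \<eta> 2)"
    have "\<exists>t. 0 < t \<and> t < \<epsilon> \<and> (\<forall>j<N. p j < t \<and> t < q j \<longleftrightarrow> j = \<eta> 1) \<and>
      (\<forall>j<N. (t + b j \<in> X) \<noteq> (t + c j \<in> X) \<longleftrightarrow> j = \<eta> 2)"
      by (rule spec[OF spec[OF spec[OF pattern[unfolded local_pattern_def]]]])
    then obtain t where t: "0 < t" "t < \<epsilon>"
      and rp: "\<forall>j<N. p j < t \<and> t < q j \<longleftrightarrow> j = \<eta> 1"
      and rb: "\<forall>j<N. (t + b j \<in> X) \<noteq> (t + c j \<in> X) \<longleftrightarrow> j = \<eta> 2"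
      by (elim exE conjE)
    define y where "y = d (\<eta> 0)"
    define x where "x = y + t"
    have uniq: "y' \<in> D \<and> y' < x \<and> x < y' + \<epsilon> \<longleftrightarrow> y' = y" for y'
    proof
      assume y': "y' \<in> D \<and> y' < x \<and> x < y' + \<epsilon>"
      have "y' < y + \<epsilon>" using y' t unfolding x_def by (meson add_strict_left_mono less_trans)
      moreover have "y < y' + \<epsilon>" using y' t(1) unfolding x_def by (meson less_add_same_cancel1 less_trans)
      ultimately show "y' = y" using d(3)[of y' "\<eta> 0"] y' by (simp add: y_def algebra_simps)
    next
      assume "y' = y"
      then show "y' \<in> D \<and> y' < x \<and> x < y' + \<epsilon>" using d(2) t by (auto simp: x_def y_def)
    qed
    have near_y: "(\<exists>y'\<in>D. y' < x \<and> x < y' + \<epsilon> \<and> Q y') \<longleftrightarrow> Q y" for Q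
    proof -
      have "(\<exists>y'\<in>D. y' < x \<and> x < y' + \<epsilon> \<and> Q y') \<longleftrightarrow>
          (\<exists>y'. (y' \<in> D \<and> y' < x \<and> x < y' + \<epsilon>) \<and> Q y')" by auto
      then show ?thesis by (simp only: uniq) simp
    qed
    have "sat M ((par i j)(0 := x)) (row i) \<longleftrightarrow> j = \<eta> i" if ij: "i \<le> 2" "j < N" for i j
    proof -
      consider "i = 0" | "i = 1" | "i = 2" using ij by linarith
      then show ?thesis
      proof cases
        case 1
        have "d j < x \<and> x < d j + \<epsilon> \<longleftrightarrow> d j = y" using uniq[of "d j"] d(2) by blast
        then show ?thesis using 1 d(1) by (simp add: row_def par_def sat_lt val_add E1 y_def inj_eq)
      next
        case 2
        then show ?thesis using rp ij(2)
          by (simp add: row_def par_def sat_near sat_lt val_add E1 near_y) (simp add: x_def)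
      next
        case 3
        then show ?thesis using rb ij(2)
          by (simp add: row_def par_def sat_near sat_trans E1 near_y) (simp add: x_def, blast)
      qed
    qed
    then show "\<exists>x. \<forall>i\<le>2. sat M ((par i (\<eta> i))(0 := x)) (row i) \<and>
        (\<forall>j<n. j \<noteq> \<eta> i \<longrightarrow> \<not> sat M ((par i j)(0 := x)) (row i))"
    proof -
      assume *: "\<And>i j. i \<le> 2 \<Longrightarrow> j < N \<Longrightarrow> sat M ((par i j)(0 := x)) (row i) \<longleftrightarrow> j = \<eta> i"
      have "\<eta> i < N" if i2: "i \<le> 2" for i
      proof -
        consider "i = 0" | "i = 1" | "i = 2" using i2 by linarith
        then show ?thesis by cases (auto simp: N_def)
      qed
      then show ?thesis using * by (intro exI[of _ x]) (auto simp: N_def)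
    qed
  qed
qed

section \<open>Dense codense and Cantor-like sets\<close>

text \<open>Every point of \<open>I\<close> is a limit of \<open>X\<close> from the right, and \<open>X\<close> has empty interior in \<open>I\<close>, so
all points of a short interval inside \<open>I\<close> serve as base points of the pattern.\<close>
lemma pattern_of_dense_codense:
  fixes X :: "'a::{linordered_ab_group_add, dense_linorder, linorder_topology} set"
  assumes bdd: "countable_sets_bounded_off_zero TYPE('a)" and div: "divisible TYPE('a)"
    and "0 < \<epsilon>" and I: "open_interval I" and X: "dense_codense_in X I"
  shows "\<exists>p q b c. local_pattern X \<epsilon> p q b c"
proof -
  have "open I" using I unfolding open_interval_def by auto
  obtain v where "v \<in> I" using I unfolding open_interval_def by blast
  obtain e where e: "0 < e" "{v - e<..<v + e} \<subseteq> I"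
    using open_contains_interval[OF \<open>0 < \<epsilon>\<close> \<open>open I\<close> \<open>v \<in> I\<close>] .
  define \<delta> where "\<delta> = min e \<epsilon>"
  have d: "0 < \<delta>" "\<delta> \<le> e" "\<delta> \<le> \<epsilon>" using e \<open>0 < \<epsilon>\<close> by (auto simp: \<delta>_def)
  have sub: "{v<..<v + \<delta>} \<subseteq> I"
  proof
    fix x assume x: "x \<in> {v<..<v + \<delta>}"
    then have "v < x" "x < v + \<delta>" by auto
    moreover have "v - e < v" "v + \<delta> \<le> v + e" using e d by auto
    ultimately have "v - e < x" "x < v + e" by order+
    then show "x \<in> I" using e by auto
  qed
  have hit: "\<exists>z. x < z \<and> z < y \<and> z \<in> Y"
    if xy: "v < x" "x < y" "y < v + \<delta>" and Y: "I \<subseteq> closure Y" for x y Y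
  proof -
    obtain w where w: "x < w" "w < y" using dense xy by blast
    then have "w \<in> I" using sub xy by (meson greaterThanLessThan_iff less_trans subsetD)
    then have "w \<in> closure Y \<inter> {x<..<y}" using Y w by auto
    then have "Y \<inter> {x<..<y} \<noteq> {}"
      using open_Int_closure_eq_empty[of "{x<..<y}" Y] by (auto simp: Int_commute)
    then show ?thesis by auto
  qed
  have "\<exists>p q b c. local_pattern X \<delta> p q b c"
  proof (rule pattern_of_accumulation[OF bdd div d(1), of "{v<..<v + \<delta>}" v])
    show "infinite {v<..<v + \<delta>}" using d by (simp add: infinite_Ioo)
    show "\<exists>z. x < z \<and> z < y \<and> z \<notin> X" if "v < x" "x < y" "y < v + \<delta>" for x y
      using hit[OF that, of "I - X"] X unfolding dense_codense_in_def by auto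
    show "\<exists>t. 0 < t \<and> t < r \<and> t + b \<in> X" if b: "b \<in> {v<..<v + \<delta>}" and "0 < r" for b r
    proof -
      have "b < min (b + r) (v + \<delta>)" using b \<open>0 < r\<close> by auto
      then obtain y where y: "b < y" "y < b + r" "y < v + \<delta>"
        using dense by (metis min_less_iff_conj)
      obtain x where x: "b < x" "x < y" using dense y by blast
      have "v < x" using b x by (meson greaterThanLessThan_iff less_trans)
      obtain z where z: "x < z" "z < y" "z \<in> X"
        using hit[OF \<open>v < x\<close> x(2) y(3), of "X \<inter> I"] X unfolding dense_codense_in_def by auto
      have "b < z" "z < b + r" using x y z by order+
      then show ?thesis using z by (intro exI[of _ "z - b"]) (simp add: algebra_simps)
    qed
  qed simp
  then show ?thesis using local_pattern_mono d(3) by blast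
qed

text \<open>A point of \<open>X\<close> that is not isolated has infinitely many points of \<open>X\<close> close by, each of which is
again a limit of \<open>X\<close>, from the right (set \<open>R\<close>) or from the left (set \<open>S\<close>). One of the two cases
occurs infinitely often.\<close>
lemma pattern_of_cantor_like:
  fixes X :: "'a::{linordered_ab_group_add, dense_linorder, linorder_topology} set"
  assumes bdd: "countable_sets_bounded_off_zero TYPE('a)" and div: "divisible TYPE('a)"
    and "0 < \<epsilon>" and X: "cantor_like X"
  shows "\<exists>p q b c. local_pattern X \<epsilon> p q b c \<or> local_pattern (uminus ` X) \<epsilon> p q b c"
proof -
  obtain v where v: "v \<in> X" using X unfolding cantor_like_def by blast
  have codense: "\<exists>z. x < z \<and> z < y \<and> z \<notin> X" if "x < y" for x y
  proof (rule ccontr)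
    assume "\<not> ?thesis"
    then have "{x<..<y} \<subseteq> closure X" using closure_subset[of X] by auto
    then have "{x<..<y} \<subseteq> interior (closure X)" by (intro interior_maximal) auto
    moreover have "interior (closure X) = {}" using X unfolding cantor_like_def by blast
    ultimately have "{x<..<y} = {}" by blast
    then show False using dense[OF that] by auto
  qed
  obtain h where h: "0 < h" "h < \<epsilon>" using dense \<open>0 < \<epsilon>\<close> by blast
  define u where "u = v - h"
  have uv: "u < v" "v < u + \<epsilon>" using h by (auto simp: u_def algebra_simps)
  define B where "B = X \<inter> {u<..<u + \<epsilon>}"
  have near: "\<exists>y\<in>X. y \<noteq> b \<and> b - e < y \<and> y < b + e" if b: "b \<in> X" and "0 < e" for b e
  proof (rule ccontr)
    assume "\<not> ?thesis"
    then have "{b - e<..<b + e} \<inter> X = {b}" using b \<open>0 < e\<close> by auto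
    then have "b isolated_in X" using b unfolding isolated_in_def by (metis open_greaterThanLessThan)
    then show False using X b unfolding cantor_like_def by blast
  qed
  have "infinite B"
  proof
    assume "finite B"
    then have "closed (B - {v})" by (intro finite_imp_closed) auto
    then have "open ({u<..<u + \<epsilon>} - (B - {v}))" by (intro open_Diff) auto
    moreover have "({u<..<u + \<epsilon>} - (B - {v})) \<inter> X = {v}" using v uv by (auto simp: B_def)
    ultimately have "v isolated_in X" using v unfolding isolated_in_def by blast
    then show False using X v unfolding cantor_like_def by blast
  qed
  define R where "R = {b\<in>B. \<forall>e>0. \<exists>t. 0 < t \<and> t < e \<and> t + b \<in> X}"
  define S where "S = {b\<in>B. \<forall>e>0. \<exists>t. 0 < t \<and> t < e \<and> b - t \<in> X}"
  have "B \<subseteq> R \<union> S"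
  proof
    fix b assume b: "b \<in> B"
    show "b \<in> R \<union> S"
    proof (rule ccontr)
      assume "b \<notin> R \<union> S"
      then obtain e1 e2 where e: "0 < e1" "\<And>t. 0 < t \<Longrightarrow> t < e1 \<Longrightarrow> t + b \<notin> X"
        "0 < e2" "\<And>t. 0 < t \<Longrightarrow> t < e2 \<Longrightarrow> b - t \<notin> X"
        using b unfolding R_def S_def by blast
      define e where "e = min e1 e2"
      obtain y where y: "y \<in> X" "y \<noteq> b" "b - e < y" "y < b + e"
        using near[of b e] b e by (auto simp: B_def e_def)
      have "e \<le> e1" "e \<le> e2" by (auto simp: e_def)
      show False
      proof (cases "b < y")
        case True
        have "y - b < e" using y by (simp add: algebra_simps)
        then have "y - b < e1" using \<open>e \<le> e1\<close> by order
        then show False using e(2)[of "y - b"] True y by simp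
      next
        case False
        then have "y < b" using y(2) by order
        have "b - y < e" using y by (simp add: algebra_simps)
        then have "b - y < e2" using \<open>e \<le> e2\<close> by order
        then show False using e(4)[of "b - y"] \<open>y < b\<close> y by simp
      qed
    qed
  qed
  then have "infinite R \<or> infinite S"
    using \<open>infinite B\<close> by (meson finite_UnI finite_subset)
  then show ?thesis
  proof
    assume "infinite R"
    have "\<exists>p q b c. local_pattern X \<epsilon> p q b c"
      by (rule pattern_of_accumulation[OF bdd div \<open>0 < \<epsilon>\<close> \<open>infinite R\<close>, of u])
        (use codense in \<open>auto simp: R_def B_def\<close>)
    then show ?thesis by blast
  next
    assume "infinite S"
    have "\<exists>p q b c. local_pattern (uminus ` X) \<epsilon> p q b c"
    proof (rule pattern_of_accumulation[OF bdd div \<open>0 < \<epsilon>\<close>, of "uminus ` S" "- (u + \<epsilon>)"])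
      show "infinite (uminus ` S)" using \<open>infinite S\<close> by (simp add: finite_image_iff)
      show "uminus ` S \<subseteq> {- (u + \<epsilon>)<..<- (u + \<epsilon>) + \<epsilon>}"
      proof
        fix b assume "b \<in> uminus ` S"
        then obtain s where s: "u < s" "s < u + \<epsilon>" "b = - s" by (auto simp: S_def B_def)
        have "- (u + \<epsilon>) < - s" using s(2) by (simp only: neg_less_iff_less)
        moreover have "- s < - u" using s(1) by simp
        ultimately show "b \<in> {- (u + \<epsilon>)<..<- (u + \<epsilon>) + \<epsilon>}" using s(3) by simp
      qed
      show "\<exists>t. 0 < t \<and> t < e \<and> t + b \<in> uminus ` X" if bS: "b \<in> uminus ` S" and "0 < e" for b e
      proof -
        obtain s where s: "s \<in> S" "b = - s" using bS by blast
        then obtain t where t: "0 < t" "t < e" "s - t \<in> X" using \<open>0 < e\<close> unfolding S_def by blast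
        have "t + b = - (s - t)" using s by simp
        then show ?thesis using t by blast
      qed
      show "\<exists>z. x < z \<and> z < y \<and> z \<notin> uminus ` X" if xy: "x < y" for x y
      proof -
        obtain z where z: "- y < z" "z < - x" "z \<notin> X" using codense[of "- y" "- x"] xy by auto
        then show ?thesis
          by (intro exI[of _ "- z"]) (auto simp: less_minus_iff minus_less_iff)
      qed
    qed
    then show ?thesis by blast
  qed
qed

theorem theorem2p9:
  fixes L :: "('f, 'r) language"
    and M :: "('f, 'r, 'a :: {linordered_ab_group_add, dense_linorder, linorder_topology}) fo_structure"
    and D :: "'a set"
  assumes "expands_ordered_group L M"
    and "divisible TYPE('a)"
    and "saturated L M (cardSuc |Th L M| )"
    and "dp_rank_at_most L M 2"
    and "definable L M D" and "infinite D" and "discrete D"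
  shows "\<not> (\<exists>X I. definable L M X \<and> open_interval I \<and> dense_codense_in X I) \<and>
         \<not> (\<exists>X. definable L M X \<and> cantor_like X)"
proof -
  have "\<exists>x\<in>D. x \<noteq> 0" using \<open>infinite D\<close> by (metis finite.simps finite_subset insert_iff subsetI)
  then obtain x :: 'a where "x \<noteq> 0" by blast
  then obtain z :: 'a where z: "0 < z" by (metis neg_0_less_iff_less linorder_neqE)
  have bdd: "countable_sets_bounded_off_zero TYPE('a)"
    using saturated_countable_sets_bounded[OF assms(1,3) z] .
  obtain d :: "nat \<Rightarrow> 'a" and \<epsilon> where d: "inj d" "range d \<subseteq> D" "0 < \<epsilon>"
    "\<And>i y. y \<in> D \<Longrightarrow> d i - \<epsilon> < y \<Longrightarrow> y < d i + \<epsilon> \<Longrightarrow> y = d i"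
    using uniformly_separated_sequence[OF bdd z \<open>infinite D\<close> \<open>discrete D\<close>] by blast
  have none: "\<not> local_pattern X \<epsilon> p q b c" if "definable L M X" for X p q b c
    using no_local_pattern[OF assms(1,4,5) that d(1,2,4)] .
  show ?thesis
    using none definable_uminus[OF assms(1)] pattern_of_dense_codense[OF bdd assms(2) d(3)]
      pattern_of_cantor_like[OF bdd assms(2) d(3)] by blast
qed

end
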